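(* Let $m\ge 1$ be an integer and let $a,b$ be the following permutations (cycles) of $\{1,2,\ldots,3m+1\}$: $$a=(1,2,\ldots,2m+1),\qquad b=(m+1,m,\ldots,1,2m+2,2m+3,\ldots,3m+1).$$ Let $\alpha=a$, $\beta=b$, $\gamma=(ab)^{-1}$, elements of $G=A_{3m+1}$, the alternating group on $3m+1$ letters. Then the latin bitrade $$T^{\circ}=\{(g\langle\alpha\rangle,g\langle\beta\rangle,g\langle\gamma\rangle)\mid g\in G\},\qquad T^{\star}=\{(g\langle\alpha\rangle,g\langle\beta\rangle,g\alpha^{-1}\langle\gamma\rangle)\mid g\in G\}$$ is thin.
   Context: Permutations are composed from left to right: $x(ab)=(xa)b$. Let $A_1,A_2,A_3$ be finite, non-empty, pairwise disjoint sets (of rows, columns and symbols, respectively). A partial latin square is a subset $T\subseteq A_1\times A_2\times A_3$ such that (P1) if $(a_1,a_2,a_3),(b_1,b_2,b_3)\in T$ then either at most one of $a_1=b_1$, $a_2=b_2$, $a_3=b_3$ is true or all three are true; (P2) every element of $A_1\cup A_2\cup A_3$ occurs as a coordinate of some element of $T$. A latin bitrade is a pair $(T^{\circ},T^{\star})$ of partial latin squares $T^{\circ},T^{\star}\subset A_1\times A_2\times A_3$ such that (R1) $T^{\circ}\cap T^{\star}=\emptyset$; (R2) for all $(a_1,a_2,a_3)\in T^{\circ}$ and all $r\ne s$ in $\{1,2,3\}$ there is a unique $(b_1,b_2,b_3)\in T^{\star}$ with $a_r=b_r$ and $a_s=b_s$; (R3) the same as (R2) with $T^{\circ}$ and $T^{\star}$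 interchanged. The pair in the claim is a latin bitrade, with $A_1,A_2,A_3$ the sets of left cosets in $G$ of $\langle\alpha\rangle,\langle\beta\rangle,\langle\gamma\rangle$. Write $i\circ j=k$ for $(i,j,k)\in T^{\circ}$ and $i\star j=k$ for $(i,j,k)\in T^{\star}$. The latin bitrade is thin if whenever $i\circ j=i'\circ j'$ with $i\ne i'$, $j\ne j'$, then $i\star j'$ is either undefined or $i\star j'=i\circ j$. *)

theory Defs
  imports "HOL-Algebra.Algebra"
begin

text \<open>Permutations are composed from left to right, so the multiplication is the
  opposite of the one in \<^const>\<open>alt_group\<close>.\<close>

definition alt_group_lr :: "nat \<Rightarrow> (nat \<Rightarrow> nat) monoid" where
  "alt_group_lr n = (alt_group n) \<lparr> mult := (\<lambda>p q. q \<circ> p) \<rparr>"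

definition coord :: "nat \<Rightarrow> 'a \<times> 'a \<times> 'a \<Rightarrow> 'a" where
  "coord r t = (if r = 1 then fst t else if r = 2 then fst (snd t) else snd (snd t))"

text \<open>The sets of rows, columns and symbols are subsets of one type, so that their
  disjointness can be stated.\<close>

definition partial_latin_square ::
    "'a set \<Rightarrow> 'a set \<Rightarrow> 'a set \<Rightarrow> ('a \<times> 'a \<times> 'a) set \<Rightarrow> bool" where
  "partial_latin_square A1 A2 A3 T \<longleftrightarrow>
     finite A1 \<and> finite A2 \<and> finite A3 \<and>
     A1 \<noteq> {} \<and> A2 \<noteq> {} \<and> A3 \<noteq> {} \<and>
     A1 \<inter> A2 = {} \<and> A1 \<inter> A3 = {} \<and> A2 \<inter> A3 = {} \<and>
     T \<subseteq> A1 \<times> A2 \<times> A3 \<and>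
     (\<forall>x\<in>T. \<forall>y\<in>T.
        card {r \<in> {1, 2, 3}. coord r x = coord r y} \<le> 1 \<or>
        (\<forall>r\<in>{1, 2, 3}. coord r x = coord r y)) \<and>
     (\<forall>z \<in> A1 \<union> A2 \<union> A3. \<exists>x\<in>T. \<exists>r\<in>{1, 2, 3}. coord r x = z)"

definition latin_bitrade ::
    "'a set \<Rightarrow> 'a set \<Rightarrow> 'a set \<Rightarrow> ('a \<times> 'a \<times> 'a) set \<Rightarrow> ('a \<times> 'a \<times> 'a) set \<Rightarrow> bool" where
  "latin_bitrade A1 A2 A3 T U \<longleftrightarrow>
     partial_latin_square A1 A2 A3 T \<and> partial_latin_square A1 A2 A3 U \<and>
     T \<inter> U = {} \<and>
     (\<forall>x\<in>T. \<forall>r\<in>{1, 2, 3}. \<forall>s\<in>{1, 2, 3}. r \<noteq> s \<longrightarrow>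
        (\<exists>!y. y \<in> U \<and> coord r x = coord r y \<and> coord s x = coord s y)) \<and>
     (\<forall>x\<in>U. \<forall>r\<in>{1, 2, 3}. \<forall>s\<in>{1, 2, 3}. r \<noteq> s \<longrightarrow>
        (\<exists>!y. y \<in> T \<and> coord r x = coord r y \<and> coord s x = coord s y))"

text \<open>\<open>T\<close> and \<open>U\<close> stand for \<open>T\<^sup>\<circ>\<close> and \<open>T\<^sup>\<star>\<close>. The two partial operations of a bitrade are read off from its
  triples: \<open>(i, j, k) \<in> T\<close> says that the product of \<open>i\<close> and \<open>j\<close> is defined and equal to \<open>k\<close>.\<close>

definition thin :: "('a \<times> 'a \<times> 'a) set \<Rightarrow> ('a \<times> 'a \<times> 'a) set \<Rightarrow> bool" where
  "thin T U \<longleftrightarrow>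
     (\<forall>i j i' j' k. (i, j, k) \<in> T \<and> (i', j', k) \<in> T \<and> i \<noteq> i' \<and> j \<noteq> j' \<longrightarrow>
        (\<nexists>l. (i, j', l) \<in> U) \<or> (i, j', k) \<in> U)"

end

theory Submission
  imports Defs
begin

text \<open>
  Let \<open>A\<close>, \<open>B\<close>, \<open>C\<close> be the subgroups generated by \<open>\<alpha>\<close>, \<open>\<beta>\<close>, \<open>\<gamma>\<close>. They intersect pairwise trivially, so
  an element \<open>g\<close> is determined by any two of \<open>gA\<close>, \<open>gB\<close>, \<open>gC\<close>; as \<open>\<alpha>\<beta>\<gamma> = 1\<close>, this makes the pair a latin
  bitrade. Thinness asks that \<open>x = \<alpha>\<close> in every relation \<open>x = zy\<close> with \<open>x \<in> A\<close>, \<open>y \<in> B\<close> and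
  \<open>1 \<noteq> z \<in> C\<close>. The points \<open>1, \<dots>, m\<close> are fixed by \<open>C\<close>, so there \<open>x = \<alpha>\<^sup>s\<close> agrees with \<open>y\<close> and takes
  values in the support of \<open>\<beta>\<close>. Hence the cyclic shift \<open>\<alpha>\<^sup>s\<close> of \<open>{1, \<dots>, 2m + 1}\<close> sends \<open>{1, \<dots>, m}\<close> into
  \<open>{1, \<dots>, m + 1}\<close>, and \<open>s\<close> is \<open>0\<close> or \<open>1\<close>; for \<open>s = 0\<close> we would get \<open>z \<in> B \<inter> C = 1\<close>.
\<close>

section \<open>The axioms of a latin bitrade\<close>

text \<open>Two candidates for \<open>y\<close> agree with \<open>x\<close>, hence with each other,
  in the coordinates \<open>r\<close> and \<open>s\<close>; so uniqueness comes from the same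
  injectivity that gives the cardinality condition of a partial latin square. By symmetry
  \<open>r < s\<close> suffices.\<close>

lemma latin_bitradeI:
  assumes fin: "finite A1" "finite A2" "finite A3"
    and ne: "A1 \<noteq> {}" "A2 \<noteq> {}" "A3 \<noteq> {}"
    and disj: "A1 \<inter> A2 = {}" "A1 \<inter> A3 = {}" "A2 \<inter> A3 = {}"
    and TU: "T \<subseteq> A1 \<times> A2 \<times> A3" "U \<subseteq> A1 \<times> A2 \<times> A3" "T \<inter> U = {}"
    and occT: "\<And>z. z \<in> A1 \<union> A2 \<union> A3 \<Longrightarrow> \<exists>x\<in>T. \<exists>r\<in>{1, 2, 3}. coord r x = z"
    and occU: "\<And>z. z \<in> A1 \<union> A2 \<union> A3 \<Longrightarrow> \<exists>x\<in>U. \<exists>r\<in>{1, 2, 3}. coord r x = z"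
    and detT: "\<And>r s x y. r \<in> {1, 2, 3} \<Longrightarrow> s \<in> {1, 2, 3} \<Longrightarrow> r < s \<Longrightarrow> x \<in> T \<Longrightarrow> y \<in> T \<Longrightarrow>
        coord r x = coord r y \<Longrightarrow> coord s x = coord s y \<Longrightarrow> x = y"
    and detU: "\<And>r s x y. r \<in> {1, 2, 3} \<Longrightarrow> s \<in> {1, 2, 3} \<Longrightarrow> r < s \<Longrightarrow> x \<in> U \<Longrightarrow> y \<in> U \<Longrightarrow>
        coord r x = coord r y \<Longrightarrow> coord s x = coord s y \<Longrightarrow> x = y"
    and exU: "\<And>r s x. r \<in> {1, 2, 3} \<Longrightarrow> s \<in> {1, 2, 3} \<Longrightarrow> r < s \<Longrightarrow> x \<in> T \<Longrightarrow>
        \<exists>y\<in>U. coord r x = coord r y \<and> coord s x = coord s y"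
    and exT: "\<And>r s x. r \<in> {1, 2, 3} \<Longrightarrow> s \<in> {1, 2, 3} \<Longrightarrow> r < s \<Longrightarrow> x \<in> U \<Longrightarrow>
        \<exists>y\<in>T. coord r x = coord r y \<and> coord s x = coord s y"
  shows "latin_bitrade A1 A2 A3 T U"
proof -
  have card: "card {r \<in> {1, 2, 3}. coord r x = coord r y} \<le> 1 \<or>
        (\<forall>r\<in>{1, 2, 3}. coord r x = coord r y)"
    if det: "\<And>r s. r \<in> {1, 2, 3} \<Longrightarrow> s \<in> {1, 2, 3} \<Longrightarrow> r < s \<Longrightarrow>
        coord r x = coord r y \<Longrightarrow> coord s x = coord s y \<Longrightarrow> x = y" for x y :: "'a \<times> 'a \<times> 'a"
  proof (cases "x = y")
    case False
    have "r = s" if "r \<in> {r \<in> {1, 2, 3}. coord r x = coord r y}"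
      "s \<in> {r \<in> {1, 2, 3}. coord r x = coord r y}" for r s
      using that det[of r s] det[of s r] False by (cases r s rule: linorder_cases) auto
    moreover have "finite {r \<in> {1, 2, 3::nat}. coord r x = coord r y}" by simp
    ultimately have "card {r \<in> {1, 2, 3}. coord r x = coord r y} \<le> Suc 0"
      by (subst card_le_Suc0_iff_eq) blast+
    then show ?thesis by simp
  qed simp
  have plsT: "partial_latin_square A1 A2 A3 T"
    unfolding partial_latin_square_def using fin ne disj TU(1) occT card detT by simp
  have plsU: "partial_latin_square A1 A2 A3 U"
    unfolding partial_latin_square_def using fin ne disj TU(2) occU card detU by simp
  have ex1: "\<exists>!y. y \<in> V \<and> coord r x = coord r y \<and> coord s x = coord s y"
    if ex: "\<exists>y\<in>V. coord r x = coord r y \<and> coord s x = coord s y"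
      and det: "\<And>y y'. y \<in> V \<Longrightarrow> y' \<in> V \<Longrightarrow> coord r y = coord r y' \<Longrightarrow> coord s y = coord s y' \<Longrightarrow> y = y'"
    for V r s and x :: "'a \<times> 'a \<times> 'a"
  proof -
    from ex obtain y where y: "y \<in> V" "coord r x = coord r y" "coord s x = coord s y" by blast
    show ?thesis
    proof (rule ex1I[of _ y])
      fix y' assume y': "y' \<in> V \<and> coord r x = coord r y' \<and> coord s x = coord s y'"
      show "y' = y" by (rule det) (use y y' in auto)
    qed (use y in simp)
  qed
  have ex1U: "\<exists>!y. y \<in> U \<and> coord r x = coord r y \<and> coord s x = coord s y"
    if "x \<in> T" "r \<in> {1, 2, 3}" "s \<in> {1, 2, 3}" "r \<noteq> s" for x r s
  proof (cases "r < s")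
    case True
    then show ?thesis using that by (intro ex1 exU detU[of r s])
  next
    case False
    with \<open>r \<noteq> s\<close> have "s < r" by simp
    then have "\<exists>!y. y \<in> U \<and> coord s x = coord s y \<and> coord r x = coord r y"
      using that by (intro ex1 exU detU[of s r])
    then show ?thesis by (simp add: conj_commute)
  qed
  have ex1T: "\<exists>!y. y \<in> T \<and> coord r x = coord r y \<and> coord s x = coord s y"
    if "x \<in> U" "r \<in> {1, 2, 3}" "s \<in> {1, 2, 3}" "r \<noteq> s" for x r s
  proof (cases "r < s")
    case True
    then show ?thesis using that by (intro ex1 exT detT[of r s])
  next
    case False
    with \<open>r \<noteq> s\<close> have "s < r" by simp
    then have "\<exists>!y. y \<in> T \<and> coord s x = coord s y \<and> coord r x = coord r y"
      using that by (intro ex1 exT detT[of s r])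
    then show ?thesis by (simp add: conj_commute)
  qed
  show ?thesis
    unfolding latin_bitrade_def
    by (intro conjI ballI impI plsT plsU TU(3) ex1U ex1T)
qed

section \<open>Left cosets of two subgroups\<close>

context group
begin

lemma l_coset_eq_iff:
  assumes "subgroup H G" "x \<in> carrier G" "y \<in> carrier G"
  shows "x <# H = y <# H \<longleftrightarrow> inv x \<otimes> y \<in> H"
  using assms
  by (metis is_group l_repr_independence lcos_self subgroup.lcos_module_imp
      subgroup.lcos_module_rev)

lemma l_coset_mult_right:
  assumes "subgroup H G" "x \<in> carrier G" "h \<in> H"
  shows "(x \<otimes> h) <# H = x <# H"
  using assms by (metis lcos_m_assoc lcos_mult_one subgroup.mem_carrier subgroup.subset coset_join3)

text \<open>As \<open>x\<close> lies in \<open>y <# K\<close>, both cosets can be based at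
  \<open>x\<close>, which then cancels. This makes rows, columns and symbols disjoint once the
  subgroups differ.\<close>

lemma l_coset_eq_imp_subgroup_eq:
  assumes "subgroup H G" "subgroup K G" "x \<in> carrier G" "y \<in> carrier G" "x <# H = y <# K"
  shows "H = K"
proof -
  have "x \<in> y <# K" using assms lcos_self by metis
  then have "x <# H = x <# K"
    using assms l_repr_independence by metis
  then show ?thesis
    using assms by (metis l_inv lcos_m_assoc lcos_mult_one subgroup.subset inv_closed)
qed

lemma lcosets_disjoint:
  assumes "subgroup H G" "subgroup K G" "H \<noteq> K"
  shows "lcosets H \<inter> lcosets K = {}"
proof (rule ccontr)
  assume "lcosets H \<inter> lcosets K \<noteq> {}"
  then obtain x y where "x \<in> carrier G" "y \<in> carrier G" "x <# H = y <# K"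
    unfolding LCOSETS_def by auto
  then show False using l_coset_eq_imp_subgroup_eq assms by simp
qed

text \<open>The quotient \<open>inv x \<otimes> y\<close> lies in both subgroups.\<close>

lemma l_coset_pair_inj:
  assumes "subgroup H G" "subgroup K G" "H \<inter> K = {\<one>}" "x \<in> carrier G" "y \<in> carrier G"
    and "x <# H = y <# H" "x <# K = y <# K"
  shows "x = y"
proof -
  have "inv x \<otimes> y \<in> H \<inter> K" using assms l_coset_eq_iff by blast
  then show ?thesis using assms by (metis inv_equality inv_inv singletonD inv_closed)
qed

end

section \<open>Bitrades from three subgroups meeting trivially\<close>

locale coset_bitrade = group +
  fixes A B C a b
  assumes finite_carrier: "finite (carrier G)"
    and subgroups: "subgroup A G" "subgroup B G" "subgroup C G"
    and inter: "A \<inter> B = {\<one>}" "A \<inter> C = {\<one>}" "B \<inter> C = {\<one>}"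
    and mem: "a \<in> A" "b \<in> B" "a \<otimes> b \<in> C"
    and nontriv: "a \<noteq> \<one>"
begin

lemma in_carrier [simp]: "a \<in> carrier G" "b \<in> carrier G"
  using mem subgroups subgroup.mem_carrier by metis+

definition "circ = {(g <# A, g <# B, g <# C) | g. g \<in> carrier G}"
definition "star = {(g <# A, g <# B, (g \<otimes> inv a) <# C) | g. g \<in> carrier G}"

lemma circ_I: "g \<in> carrier G \<Longrightarrow> (g <# A, g <# B, g <# C) \<in> circ"
  unfolding circ_def by blast

lemma star_I: "g \<in> carrier G \<Longrightarrow> (g <# A, g <# B, (g \<otimes> inv a) <# C) \<in> star"
  unfolding star_def by blast

lemma circ_E:
  assumes "(i, j, k) \<in> circ"
  obtains g where "g \<in> carrier G" "i = g <# A" "j = g <# B" "k = g <# C"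
  using assms unfolding circ_def by auto

lemma star_E:
  assumes "(i, j, k) \<in> star"
  obtains g where "g \<in> carrier G" "i = g <# A" "j = g <# B" "k = (g \<otimes> inv a) <# C"
  using assms unfolding star_def by auto

lemma shift_row: "g \<in> carrier G \<Longrightarrow> (g \<otimes> inv a) <# A = g <# A"
  using l_coset_mult_right mem subgroups subgroup.m_inv_closed by metis

lemma shift_column: "g \<in> carrier G \<Longrightarrow> (g \<otimes> b) <# B = g <# B"
  using l_coset_mult_right mem subgroups by metis

text \<open>The quotient of the two representatives is \<open>a \<otimes> b\<close>. With
  \<open>shift_row\<close> and \<open>shift_column\<close>, the \<open>star\<close> triple of
  \<open>g\<close> thus shares row and symbol with the \<open>circ\<close> triple of
  \<open>g \<otimes> inv a\<close>, and column and symbol with that of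
  \<open>g \<otimes> b\<close>.\<close>

lemma shift_symbol:
  assumes "g \<in> carrier G"
  shows "(g \<otimes> inv a) <# C = (g \<otimes> b) <# C"
proof -
  have "inv (g \<otimes> inv a) \<otimes> (g \<otimes> b) = a \<otimes> b"
    using assms by (simp add: inv_mult_group m_assoc inv_solve_left')
  then show ?thesis
    using l_coset_eq_iff subgroups mem assms by simp
qed

lemma subgroups_ne: "A \<noteq> B" "A \<noteq> C" "B \<noteq> C"
proof -
  show "A \<noteq> B" "A \<noteq> C" using inter mem nontriv by auto
  show "B \<noteq> C"
  proof
    assume "B = C"
    \<comment> \<open>Here \<open>B\<close> equals the trivial intersection, and it contains both
      \<open>b\<close> and the product.\<close>
    then have "b = \<one>" "a \<otimes> b = \<one>" using inter mem by auto
    then show False using nontriv by simp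
  qed
qed

lemma latin_bitrade: "latin_bitrade (lcosets A) (lcosets B) (lcosets C) circ star"
proof (rule latin_bitradeI)
  show "finite (lcosets A)" "finite (lcosets B)" "finite (lcosets C)"
    unfolding LCOSETS_def using finite_carrier by auto
  show "lcosets A \<noteq> {}" "lcosets B \<noteq> {}" "lcosets C \<noteq> {}"
    unfolding LCOSETS_def by auto
  show "lcosets A \<inter> lcosets B = {}" "lcosets A \<inter> lcosets C = {}" "lcosets B \<inter> lcosets C = {}"
    using lcosets_disjoint subgroups subgroups_ne by simp_all
  show "circ \<subseteq> (lcosets A) \<times> (lcosets B) \<times> (lcosets C)"
    unfolding circ_def LCOSETS_def by auto
  show "star \<subseteq> (lcosets A) \<times> (lcosets B) \<times> (lcosets C)"
    unfolding star_def LCOSETS_def by (fastforce intro: m_closed)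
  show "circ \<inter> star = {}"
  proof (rule ccontr)
    assume "circ \<inter> star \<noteq> {}"
    then obtain g h where gh: "g \<in> carrier G" "h \<in> carrier G" "g <# A = h <# A" "g <# B = h <# B"
      "g <# C = (h \<otimes> inv a) <# C"
      unfolding circ_def star_def by blast
    then have "g = h" by (intro l_coset_pair_inj[OF subgroups(1,2) inter(1)])
    \<comment> \<open>Both elements have the same row by \<open>shift_row\<close> and the same
      symbol by assumption.\<close>
    with gh have "g = g \<otimes> inv a"
      by (intro l_coset_pair_inj[OF subgroups(1,3) inter(2)]) (simp_all add: shift_row)
    then have "inv a = \<one>" using gh(1) l_cancel_one'[of g "inv a"] by simp
    then show False using nontriv by simp
  qed
next
  fix z assume "z \<in> lcosets A \<union> lcosets B \<union> lcosets C"
  then obtain g where g: "g \<in> carrier G" "z = g <# A \<or> z = g <# B \<or> z = g <# C"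
    unfolding LCOSETS_def by auto
  show "\<exists>x\<in>circ. \<exists>r\<in>{1, 2, 3}. coord r x = z"
    by (rule bexI[OF _ circ_I[OF g(1)]]) (use g(2) in \<open>auto simp: coord_def\<close>)
  \<comment> \<open>The symbol in a \<open>star\<close> triple is shifted by \<open>inv a\<close>,
    so \<open>g <# C\<close> is found at \<open>g \<otimes> a\<close>.\<close>
  have "(g \<otimes> a \<otimes> inv a) <# C = g <# C" using g by (simp add: m_assoc)
  then have "(g \<otimes> a <# A, g \<otimes> a <# B, g <# C) \<in> star"
    using star_I[of "g \<otimes> a"] g(1) by simp
  with g(2) show "\<exists>x\<in>star. \<exists>r\<in>{1, 2, 3}. coord r x = z"
  proof (elim disjE)
    assume "z = g <# C"
    then show ?thesis
      by (intro bexI[OF _ \<open>(g \<otimes> a <# A, g \<otimes> a <# B, g <# C) \<in> star\<close>]) (simp add: coord_def)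
  qed (rule bexI[OF _ star_I[OF g(1)]], simp add: coord_def)+
next
  fix r s and x y :: "'a set \<times> 'a set \<times> 'a set"
  assume rs: "r \<in> {1, 2, 3::nat}" "s \<in> {1, 2, 3::nat}" "r < s" and "x \<in> circ" "y \<in> circ"
    and eq: "coord r x = coord r y" "coord s x = coord s y"
  from \<open>x \<in> circ\<close> \<open>y \<in> circ\<close> obtain g h where gh: "g \<in> carrier G" "h \<in> carrier G"
    "x = (g <# A, g <# B, g <# C)" "y = (h <# A, h <# B, h <# C)"
    unfolding circ_def by auto
  consider "r = 1" "s = 2" | "r = 1" "s = 3" | "r = 2" "s = 3" using rs by auto
  then have "g = h"
  proof cases
    case 1
    with eq gh show ?thesis
      by (intro l_coset_pair_inj[OF subgroups(1,2) inter(1)]) (simp_all add: coord_def)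
  next
    case 2
    with eq gh show ?thesis
      by (intro l_coset_pair_inj[OF subgroups(1,3) inter(2)]) (simp_all add: coord_def)
  next
    case 3
    with eq gh show ?thesis
      by (intro l_coset_pair_inj[OF subgroups(2,3) inter(3)]) (simp_all add: coord_def)
  qed
  then show "x = y" using gh by simp
next
  fix r s and x y :: "'a set \<times> 'a set \<times> 'a set"
  assume rs: "r \<in> {1, 2, 3::nat}" "s \<in> {1, 2, 3::nat}" "r < s" and "x \<in> star" "y \<in> star"
    and eq: "coord r x = coord r y" "coord s x = coord s y"
  from \<open>x \<in> star\<close> \<open>y \<in> star\<close> obtain g h where gh: "g \<in> carrier G" "h \<in> carrier G"
    and xy: "x = (g <# A, g <# B, (g \<otimes> inv a) <# C)" "y = (h <# A, h <# B, (h \<otimes> inv a) <# C)"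
    unfolding star_def by auto
  consider "r = 1" "s = 2" | "r = 1" "s = 3" | "r = 2" "s = 3" using rs by auto
  then have "g = h"
  proof cases
    case 1
    with eq gh xy show ?thesis
      by (intro l_coset_pair_inj[OF subgroups(1,2) inter(1)]) (simp_all add: coord_def)
  next
    case 2
    \<comment> \<open>Row and symbol of the \<open>star\<close> triple of \<open>g\<close> are
      cosets of the one element \<open>g \<otimes> inv a\<close>; in the next case column and symbol
      are cosets of \<open>g \<otimes> b\<close>.\<close>
    with eq gh xy have "g \<otimes> inv a = h \<otimes> inv a"
      by (intro l_coset_pair_inj[OF subgroups(1,3) inter(2)]) (simp_all add: coord_def shift_row)
    then show ?thesis using gh by simp
  next
    case 3
    with eq gh xy have "g \<otimes> b = h \<otimes> b"
      by (intro l_coset_pair_inj[OF subgroups(2,3) inter(3)])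
        (simp_all add: coord_def shift_column shift_symbol)
    then show ?thesis using gh by simp
  qed
  then show "x = y" using xy by simp
next
  fix r s and x :: "'a set \<times> 'a set \<times> 'a set"
  assume rs: "r \<in> {1, 2, 3::nat}" "s \<in> {1, 2, 3::nat}" "r < s" and "x \<in> circ"
  then obtain g where g: "g \<in> carrier G" and x: "x = (g <# A, g <# B, g <# C)"
    unfolding circ_def by auto
  \<comment> \<open>These undo the two shifts: \<open>h\<close> serves for row and symbol,
    \<open>k\<close> for column and symbol.\<close>
  define h k where "h = g \<otimes> a" and "k = g \<otimes> inv b"
  then have [simp]: "h \<in> carrier G" "k \<in> carrier G" and hk: "g = h \<otimes> inv a" "g = k \<otimes> b"
    using g by (simp_all add: m_assoc)
  have "h <# A = g <# A" "k <# B = g <# B" "(k \<otimes> inv a) <# C = g <# C"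
    using shift_row[of h] shift_column[of k] shift_symbol[of k] hk by simp_all
  note hk_cosets = this
  consider "r = 1" "s = 2" | "r = 1" "s = 3" | "r = 2" "s = 3" using rs by auto
  then show "\<exists>y\<in>star. coord r x = coord r y \<and> coord s x = coord s y"
  proof cases
    case 1
    show ?thesis by (rule bexI[OF _ star_I[OF g]]) (simp add: 1 x coord_def)
  next
    case 2
    show ?thesis by (rule bexI[OF _ star_I[of h]]) (simp_all add: 2 x coord_def hk_cosets flip: hk(1))
  next
    case 3
    show ?thesis by (rule bexI[OF _ star_I[of k]]) (simp_all add: 3 x coord_def hk_cosets)
  qed
next
  fix r s and x :: "'a set \<times> 'a set \<times> 'a set"
  assume rs: "r \<in> {1, 2, 3::nat}" "s \<in> {1, 2, 3::nat}" "r < s" and "x \<in> star"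
  then obtain g where g: "g \<in> carrier G" and x: "x = (g <# A, g <# B, (g \<otimes> inv a) <# C)"
    unfolding star_def by auto
  consider "r = 1" "s = 2" | "r = 1" "s = 3" | "r = 2" "s = 3" using rs by auto
  then show "\<exists>y\<in>circ. coord r x = coord r y \<and> coord s x = coord s y"
  proof cases
    case 1
    show ?thesis by (rule bexI[OF _ circ_I[OF g]]) (simp add: 1 x coord_def)
  next
    case 2
    show ?thesis
      by (rule bexI[OF _ circ_I[of "g \<otimes> inv a"]]) (simp_all add: 2 x coord_def shift_row g)
  next
    case 3
    show ?thesis
      by (rule bexI[OF _ circ_I[of "g \<otimes> b"]])
        (simp_all add: 3 x coord_def shift_column shift_symbol g)
  qed
qed

text \<open>Let \<open>g\<close>, \<open>h\<close> give \<open>circ\<close> triples with a common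
  symbol, and \<open>f\<close> a \<open>star\<close> triple in the row of \<open>g\<close> and the
  column of \<open>h\<close>. Then \<open>inv g \<otimes> f\<close>,
  \<open>inv h \<otimes> f\<close>, \<open>inv g \<otimes> h\<close> are the \<open>x\<close>,
  \<open>y\<close>, \<open>z\<close> of \<open>rel\<close>, with \<open>z\<close> nontrivial because
  the rows differ.\<close>

lemma thin:
  assumes rel: "\<And>x y z. x \<in> A \<Longrightarrow> y \<in> B \<Longrightarrow> z \<in> C \<Longrightarrow> x = z \<otimes> y \<Longrightarrow> z \<noteq> \<one> \<Longrightarrow> x = a"
  shows "thin circ star"
  unfolding thin_def
proof (intro allI impI, elim conjE)
  fix i j i' j' k
  assume ij: "(i, j, k) \<in> circ" and ij': "(i', j', k) \<in> circ" and ne: "i \<noteq> i'" "j \<noteq> j'"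
  obtain g where g: "g \<in> carrier G" "i = g <# A" "j = g <# B" "k = g <# C"
    using ij by (rule circ_E)
  obtain h where h: "h \<in> carrier G" "i' = h <# A" "j' = h <# B" "k = h <# C"
    using ij' by (rule circ_E)
  have "(i, j', k) \<in> star" if l: "(i, j', l) \<in> star" for l
  proof -
    obtain f where f: "f \<in> carrier G" "i = f <# A" "j' = f <# B" "l = (f \<otimes> inv a) <# C"
      using l by (rule star_E)
    have "inv g \<otimes> f \<in> A" "inv h \<otimes> f \<in> B" "inv g \<otimes> h \<in> C"
      using l_coset_eq_iff[OF subgroups(1) g(1) f(1)] l_coset_eq_iff[OF subgroups(2) h(1) f(1)]
        l_coset_eq_iff[OF subgroups(3) g(1) h(1)] f(2,3) g(2,4) h(3,4) by simp_all
    moreover have "inv g \<otimes> f = (inv g \<otimes> h) \<otimes> (inv h \<otimes> f)"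
    proof -
      have "h \<otimes> (inv h \<otimes> f) = f" using f(1) h(1) by (simp flip: m_assoc)
      then show ?thesis using f(1) g(1) h(1) by (simp add: m_assoc)
    qed
    moreover have "inv g \<otimes> h \<noteq> \<one>"
    proof
      assume "inv g \<otimes> h = \<one>"
      then have "g = h" using g(1) h(1) by (metis inv_equality inv_inv inv_closed)
      then show False using g(2) h(2) ne(1) by simp
    qed
    ultimately have "inv g \<otimes> f = a" using rel by blast
    \<comment> \<open>So the symbol of the \<open>star\<close> triple of \<open>f\<close> is
      \<open>g <# C\<close>, which is \<open>k\<close>.\<close>
    then have "f \<otimes> inv a = g"
      using f(1) g(1) in_carrier(1) inv_solve_left' inv_solve_right' by metis
    then show ?thesis using star_I[OF f(1)] f g by simp
  qed
  then show "(\<nexists>l. (i, j', l) \<in> star) \<or> (i, j', k) \<in> star" by blast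
qed

end

section \<open>Powers of a cycle\<close>

lemma funpow_cycle_of_list_nth:
  assumes "cycle cs" "i < length cs"
  shows "(cycle_of_list cs ^^ n) (cs ! i) = cs ! ((n + i) mod length cs)"
  using cyclic_rotation[OF assms(1), of n] assms(2) nth_rotate
  by (metis add.commute nth_map)

text \<open>The power adds \<open>n\<close> to indices modulo the length; one fixed entry makes the
  length divide \<open>n\<close>, and then every entry is fixed.\<close>

lemma funpow_cycle_of_list_eq_id:
  assumes "cycle cs" "x \<in> set cs" "(cycle_of_list cs ^^ n) x = x"
  shows "cycle_of_list cs ^^ n = id"
proof
  fix y
  obtain i where i: "i < length cs" "x = cs ! i" using assms(2) by (metis in_set_conv_nth)
  then have "(n + i) mod length cs = i"
    using assms funpow_cycle_of_list_nth[OF assms(1)]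
    by (metis mod_less_divisor nth_eq_iff_index_eq length_pos_if_in_set)
  then have "length cs dvd n"
    using i(1) by (metis add_diff_cancel_right' dvd_minus_mod)
  show "(cycle_of_list cs ^^ n) y = id y"
  proof (cases "y \<in> set cs")
    case True
    then obtain j where "j < length cs" "y = cs ! j" by (metis in_set_conv_nth)
    then show ?thesis
      using funpow_cycle_of_list_nth[OF assms(1)] \<open>length cs dvd n\<close> by (auto elim!: dvdE)
  next
    case False
    then show ?thesis by (induct n) (simp_all add: id_outside_supp)
  qed
qed

text \<open>A cycle is a product of one transposition fewer than its length.\<close>

lemma cycle_of_list_in_alt_group:
  assumes "cycle cs" "odd (length cs)" "set cs \<subseteq> {1..n}"
  shows "cycle_of_list cs \<in> carrier (alt_group n)"
proof -
  have "swapidseq (length cs - 1) (cycle_of_list cs)"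
    using swapidseq_ext_of_cycles swapidseq_ext_imp_swapidseq assms(1) by blast
  then have "evenperm (cycle_of_list cs)"
    using assms(2) by (simp add: evenperm_unique)
  then show ?thesis
    using cycle_permutes permutes_subset assms(3) by (auto simp: alt_group_carrier)
qed

section \<open>The alternating group with left-to-right composition\<close>

lemma alt_group_lr_simps [simp]:
  "carrier (alt_group_lr n) = carrier (alt_group n)"
  "\<one>\<^bsub>alt_group_lr n\<^esub> = id"
  "p \<otimes>\<^bsub>alt_group_lr n\<^esub> q = q \<circ> p"
  by (simp_all add: alt_group_lr_def alt_group_one)

lemma alt_group_lr_is_group: "group (alt_group_lr n)"
proof -
  interpret alt: group "alt_group n" by (rule alt_group_is_group)
  show ?thesis
  proof (rule groupI)
    fix p q assume "p \<in> carrier (alt_group_lr n)" "q \<in> carrier (alt_group_lr n)"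
    then show "p \<otimes>\<^bsub>alt_group_lr n\<^esub> q \<in> carrier (alt_group_lr n)"
      using alt.m_closed[of q p] by (simp add: alt_group_mult)
  next
    show "\<one>\<^bsub>alt_group_lr n\<^esub> \<in> carrier (alt_group_lr n)"
      using alt.one_closed by (simp add: alt_group_one)
  next
    fix p assume "p \<in> carrier (alt_group_lr n)"
    \<comment> \<open>A left inverse for the reversed product is a right inverse in
      \<open>alt_group\<close>.\<close>
    then have "p \<circ> inv\<^bsub>alt_group n\<^esub> p = id" "inv\<^bsub>alt_group n\<^esub> p \<in> carrier (alt_group n)"
      using alt.r_inv[of p] by (simp_all add: alt_group_mult alt_group_one)
    then show "\<exists>q\<in>carrier (alt_group_lr n). q \<otimes>\<^bsub>alt_group_lr n\<^esub> p = \<one>\<^bsub>alt_group_lr n\<^esub>"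
      by auto
  qed (simp_all add: comp_assoc)
qed

lemma finite_alt_group: "finite (carrier (alt_group n))"
  by (rule finite_subset[OF _ finite_permutations[of "{1..n}"]]) (auto simp: alt_group_carrier)

lemma alt_group_lr_pow: "p [^]\<^bsub>alt_group_lr n\<^esub> (k::nat) = p ^^ k"
  by (induct k) (simp_all add: nat_pow_def)

text \<open>In a finite group the powers with natural exponents exhaust a cyclic subgroup.\<close>

lemma generate_alt_group_lr:
  assumes "p \<in> carrier (alt_group n)"
  shows "generate (alt_group_lr n) {p} = range ((^^) p)"
  using group.generate_pow_on_finite_carrier[OF alt_group_lr_is_group, of n p] assms finite_alt_group
  by (auto simp: alt_group_lr_pow)

theorem lemma4p18:
  fixes m :: nat
    and G :: "(nat \<Rightarrow> nat) monoid"
    and a b \<alpha> \<beta> \<gamma> :: "nat \<Rightarrow> nat"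
    and A1 A2 A3 :: "(nat \<Rightarrow> nat) set set"
    and T U :: "((nat \<Rightarrow> nat) set \<times> (nat \<Rightarrow> nat) set \<times> (nat \<Rightarrow> nat) set) set"
  assumes "m \<ge> 1"
    and "G = alt_group_lr (3 * m + 1)"
    and "a = cycle_of_list [1..<2 * m + 2]"
    and "b = cycle_of_list (rev [1..<m + 2] @ [2 * m + 2..<3 * m + 2])"
    and "\<alpha> = a" and "\<beta> = b" and "\<gamma> = inv\<^bsub>G\<^esub> (a \<otimes>\<^bsub>G\<^esub> b)"
    and "A1 = lcosets\<^bsub>G\<^esub> (generate G {\<alpha>})"
    and "A2 = lcosets\<^bsub>G\<^esub> (generate G {\<beta>})"
    and "A3 = lcosets\<^bsub>G\<^esub> (generate G {\<gamma>})"
    and "T = {(g <#\<^bsub>G\<^esub> generate G {\<alpha>}, g <#\<^bsub>G\<^esub> generate G {\<beta>},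
               g <#\<^bsub>G\<^esub> generate G {\<gamma>}) | g. g \<in> carrier G}"
    and "U = {(g <#\<^bsub>G\<^esub> generate G {\<alpha>}, g <#\<^bsub>G\<^esub> generate G {\<beta>},
               (g \<otimes>\<^bsub>G\<^esub> inv\<^bsub>G\<^esub> \<alpha>) <#\<^bsub>G\<^esub> generate G {\<gamma>}) | g. g \<in> carrier G}"
  shows "\<alpha> \<in> carrier G \<and> \<beta> \<in> carrier G \<and> \<gamma> \<in> carrier G \<and>
         latin_bitrade A1 A2 A3 T U \<and> thin T U"
proof -
  define as where "as = [1..<2 * m + 2]"
  define bs where "bs = rev [1..<m + 2] @ [2 * m + 2..<3 * m + 2]"
  have as: "cycle as" "length as = 2 * m + 1" "set as = {1..2 * m + 1}"
    unfolding as_def by auto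
  have bs: "cycle bs" "length bs = 2 * m + 1" "set bs = {1..m + 1} \<union> {2 * m + 2..3 * m + 1}"
    unfolding bs_def by auto
  have a: "a = cycle_of_list as" and b: "b = cycle_of_list bs"
    using assms(3,4) unfolding as_def bs_def by simp_all
  interpret group G unfolding assms(2) by (rule alt_group_lr_is_group)
  \<comment> \<open>Both lists have the odd length \<open>2 * m + 1\<close>, so the cycles are
    even.\<close>
  have aG: "a \<in> carrier G" and bG: "b \<in> carrier G"
    unfolding a b assms(2) using as bs by (auto intro!: cycle_of_list_in_alt_group)
  then have \<gamma>G: "\<gamma> \<in> carrier G" unfolding assms(7) by (intro inv_closed m_closed)
  have one: "\<one>\<^bsub>G\<^esub> = id" and mult: "\<And>p q. p \<otimes>\<^bsub>G\<^esub> q = q \<circ> p"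
    unfolding assms(2) by simp_all
  define A B C where "A = generate G {\<alpha>}" and "B = generate G {\<beta>}" and "C = generate G {\<gamma>}"
  have A: "A = range ((^^) a)" and B: "B = range ((^^) b)" and C: "C = range ((^^) \<gamma>)"
    unfolding A_def B_def C_def assms(2)
    using aG bG \<gamma>G generate_alt_group_lr assms(2,5,6) by auto
  have sub: "subgroup A G" "subgroup B G" "subgroup C G"
    unfolding A_def B_def C_def using aG bG \<gamma>G assms(5,6) by (auto intro!: generate_is_subgroup)

  \<comment> \<open>Action of the three cyclic groups on the points\<close>
  have as_nth: "as ! i = i + 1" if "i < 2 * m + 1" for i
    unfolding as_def using that by (subst nth_upt) auto
  \<comment> \<open>The point \<open>x\<close> has index \<open>x - 1\<close> in \<open>as\<close>,
    hence the corrections by one around the remainder.\<close>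
  have a_pow: "(a ^^ s) x = (x - 1 + s) mod (2 * m + 1) + 1" if "x \<in> {1..2 * m + 1}" for s x
  proof -
    have x: "x = as ! (x - 1)" "x - 1 < length as" using that as_nth[of "x - 1"] as(2) by auto
    have "(a ^^ s) x = as ! ((s + (x - 1)) mod length as)"
      using funpow_cycle_of_list_nth[OF as(1) x(2), of s] unfolding a x(1)[symmetric] .
    also have "\<dots> = (s + (x - 1)) mod length as + 1"
      unfolding as(2) by (rule as_nth) simp
    finally show ?thesis using as(2) by (simp add: add.commute)
  qed
  have b_step: "b (x + 1) = x" if "x \<in> {1..m}" for x
  proof -
    \<comment> \<open>Both indices lie in the first, descending part of \<open>bs\<close>, where
      \<open>x + 1\<close> is followed by \<open>x\<close>.\<close>
    have "m - x < m + 1" "m + 1 - x < m + 1" using that by auto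
    then have "bs ! (m - x) = x + 1" "bs ! (m + 1 - x) = x"
      using that unfolding bs_def by (auto simp: nth_append rev_nth simp del: upt_Suc)
    moreover have "(cycle_of_list bs ^^ 1) (bs ! (m - x)) = bs ! ((1 + (m - x)) mod length bs)"
      by (rule funpow_cycle_of_list_nth) (use bs that in auto)
    moreover have "(1 + (m - x)) mod length bs = m + 1 - x"
      unfolding bs(2) using that by (subst mod_less) auto
    ultimately show ?thesis using b by simp
  qed
  \<comment> \<open>In the product \<open>a\<close> acts first and raises \<open>x\<close> to
    \<open>x + 1\<close>, which \<open>b\<close> lowers again; \<gamma> is the inverse of this
    product.\<close>
  have \<gamma>_fix: "\<gamma> x = x" if "x \<in> {1..m}" for x
  proof -
    have "(a \<otimes>\<^bsub>G\<^esub> b) x = x"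
      using a_pow[of x 1] b_step[OF that] that by (simp add: mult)
    moreover have "(a \<otimes>\<^bsub>G\<^esub> b) \<otimes>\<^bsub>G\<^esub> \<gamma> = id"
      using aG bG one r_inv[of "a \<otimes>\<^bsub>G\<^esub> b"] unfolding assms(7) by simp
    ultimately show ?thesis unfolding mult by (metis comp_apply id_apply)
  qed
  have C_fix: "z x = x" if "z \<in> C" "x \<in> {1..m}" for x z
  proof -
    have "(\<gamma> ^^ n) x = x" for n using \<gamma>_fix[OF that(2)] by (induct n) simp_all
    then show ?thesis using that(1) C by auto
  qed
  have A_id: "p = id" if "p \<in> A" "p x = x" "x \<in> {1..2 * m + 1}" for p x
    using that A a funpow_cycle_of_list_eq_id[OF as(1)] as(3) by blast
  have B_id: "p = id" if "p \<in> B" "p x = x" "x \<in> {1..m + 1}" for p x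
    using that B b funpow_cycle_of_list_eq_id[OF bs(1)] bs(3) by blast
  have B_fix: "p x = x" if "p \<in> B" "x \<in> {m + 2..2 * m + 1}" for p x
  proof -
    have "b x = x" unfolding b by (rule id_outside_supp) (use that bs(3) in auto)
    then have "(b ^^ n) x = x" for n by (induct n) simp_all
    then show ?thesis using that(1) B by auto
  qed
  have B_supp: "p x \<in> set bs" if "p \<in> B" "x \<in> set bs" for p x
    using that B b permutes_in_image[OF permutes_funpow[OF cycle_permutes[of bs]]] by auto

  interpret coset_bitrade G A B C a b
  proof (intro coset_bitrade.intro coset_bitrade_axioms.intro)
    show "group G" by (rule is_group)
    show "finite (carrier G)" using finite_alt_group assms(2) by simp
    show "subgroup A G" "subgroup B G" "subgroup C G" by (fact sub)+
    \<comment> \<open>The point \<open>m + 2\<close> is at most \<open>2 * m + 1\<close> as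
      \<open>m \<ge> 1\<close>; it lies on the cycle \<open>a\<close> but is fixed by
      \<open>B\<close>. For the other two intersections the point \<open>1\<close> serves, being
      fixed by \<open>C\<close>.\<close>
    have "p = id" if "p \<in> A" "p \<in> B" for p
      using A_id[of p "m + 2"] B_fix[of p "m + 2"] that assms(1) by simp
    then show "A \<inter> B = {\<one>\<^bsub>G\<^esub>}"
      using sub one by (auto dest: subgroup.one_closed)
    have "p = id" if "p \<in> A" "p \<in> C" for p
      using A_id[of p 1] C_fix[of p 1] that assms(1) by simp
    then show "A \<inter> C = {\<one>\<^bsub>G\<^esub>}"
      using sub one by (auto dest: subgroup.one_closed)
    have "p = id" if "p \<in> B" "p \<in> C" for p
      using B_id[of p 1] C_fix[of p 1] that assms(1) by simp
    then show "B \<inter> C = {\<one>\<^bsub>G\<^esub>}"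
      using sub one by (auto dest: subgroup.one_closed)
    show "a \<in> A" "b \<in> B"
      unfolding A_def B_def using assms(5,6) by (auto intro: generate.incl)
    have "inv\<^bsub>G\<^esub> \<gamma> \<in> C" unfolding C_def by (auto intro: generate.inv)
    then show "a \<otimes>\<^bsub>G\<^esub> b \<in> C" unfolding assms(7) using aG bG by simp
    show "a \<noteq> \<one>\<^bsub>G\<^esub>"
      using a_pow[of 1 1] assms(1) one by auto
  qed
  have TU: "T = circ" "U = star"
    unfolding circ_def star_def unfolding assms(5,6,11,12) A_def B_def C_def by (rule refl)+
  have "thin T U" unfolding TU
  proof (rule thin)
    fix x y z assume xyz: "x \<in> A" "y \<in> B" "z \<in> C" "x = z \<otimes>\<^bsub>G\<^esub> y" "z \<noteq> \<one>\<^bsub>G\<^esub>"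
    obtain s0 where s0: "x = a ^^ s0" using xyz(1) A by auto
    \<comment> \<open>Reducing the exponent does not change the power of \<open>a\<close> on its
      support.\<close>
    define s where "s = s0 mod (2 * m + 1)"
    have "s \<le> 2 * m" unfolding s_def using mod_less_divisor[of "2 * m + 1" s0] by linarith
    have x: "x i = (i - 1 + s) mod (2 * m + 1) + 1" if "i \<in> {1..2 * m + 1}" for i
      unfolding s0 s_def using a_pow[OF that] by (simp add: mod_add_right_eq)
    \<comment> \<open>As \<open>z\<close> acts first and fixes \<open>i\<close>, the values of
      \<open>x\<close> and \<open>y\<close> at \<open>i\<close> agree; they lie on both cycles,
      whose common points are \<open>1\<close> to \<open>m + 1\<close>.\<close>
    have bound: "x i \<le> m + 1" if "i \<in> {1..m}" for i
    proof -
      have "x i = y i" using C_fix[OF xyz(3) that] xyz(4) by (simp add: mult)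
      then have "x i \<in> set bs" using B_supp[OF xyz(2), of i] that bs(3) by auto
      moreover have "x i \<le> 2 * m + 1"
        using x[of i] that mod_less_divisor[of "2 * m + 1" "i - 1 + s"] by simp
      ultimately show ?thesis using bs(3) by auto
    qed
    \<comment> \<open>The image of \<open>1\<close> is \<open>s + 1\<close>.\<close>
    have "s \<le> m"
      using bound[of 1] x[of 1] assms(1) \<open>s \<le> 2 * m\<close> by simp
    \<comment> \<open>By the previous bound the shift of \<open>m\<close> does not wrap around, so
      its image is \<open>m + s\<close>.\<close>
    moreover have "m - 1 + s \<le> m"
      using bound[of m] x[of m] assms(1) \<open>s \<le> m\<close> by simp
    ultimately consider "s = 0" | "s = 1" using assms(1) by linarith
    then show "x = a"
    proof cases
      case 1
      \<comment> \<open>Now \<open>x\<close> fixes \<open>1\<close>, which forces \<open>z\<close>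
        to be the inverse of \<open>y\<close> and so to lie in both \<open>B\<close> and
        \<open>C\<close>.\<close>
      then have "x = id" using A_id[OF xyz(1), of 1] x[of 1] by simp
      then have "z = inv\<^bsub>G\<^esub> y"
        using xyz sub one by (metis inv_equality subgroup.mem_carrier)
      then have "z \<in> B" using xyz(2) sub(2) by (simp add: subgroup.m_inv_closed)
      then show ?thesis using inter(3) xyz by blast
    next
      case 2
      \<comment> \<open>Both \<open>x\<close> and \<open>a\<close> send \<open>1\<close> to
        \<open>2\<close>, so their quotient is an element of \<open>A\<close> with a fixed point on
        the cycle.\<close>
      have "x \<otimes>\<^bsub>G\<^esub> inv\<^bsub>G\<^esub> a \<in> A"
        using xyz(1) sub(1) mem(1) by (simp add: subgroup.m_closed subgroup.m_inv_closed)
      moreover have "(x \<otimes>\<^bsub>G\<^esub> inv\<^bsub>G\<^esub> a) 1 = 1"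
      proof -
        have "x 1 = a 1" using x[of 1] a_pow[of 1 1] 2 by simp
        moreover have "a \<otimes>\<^bsub>G\<^esub> inv\<^bsub>G\<^esub> a = id" using aG one by simp
        ultimately show ?thesis unfolding mult by (metis comp_apply id_apply)
      qed
      ultimately have "x \<otimes>\<^bsub>G\<^esub> inv\<^bsub>G\<^esub> a = \<one>\<^bsub>G\<^esub>" using A_id one by auto
      then show ?thesis
        using xyz(1) sub(1) by (metis aG inv_equality inv_inv inv_closed subgroup.mem_carrier)
    qed
  qed
  then show ?thesis
    using aG bG \<gamma>G latin_bitrade TU assms(5,6,8-10) unfolding A_def B_def C_def by simp
qed

end
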